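(* Let $M>n>m$. Given samples $s_1^*,\dots,s_M^*\in\mathbb{R}^n$, a number $m$ of basis elements, and an initial partition $I_1,\dots,I_K$ of $\{1,\dots,M\}$ into $K$ clusters, the $K$-SVD algorithm (defined in the context) converges in a finite number of steps to a local minimum of the optimization problem $$\min_{J,\{\Phi_j,\phi_0^j\}_{j=1}^K}\ \sum_{i=1}^M \min_{v}\left\|s_i^*-\Phi_{J(i)}v-\phi_0^{J(i)}\right\|_2^2$$ $$\text{subject to}\quad \phi_0^j=\frac{1}{M_j}\sum_{i\in I_j}s_i^*,\qquad j=1,\dots,K,$$ where $J\in\{1,\dots,K\}^M$ is a sequence of cluster labels, namely $J(i)=j$ implies that $s_i^*$ belongs to cluster $j$, $I_j=\{i\in\{1,\dots,M\}:\ J(i)=j\}$, $M_j=\mathrm{card}(I_j)$, and where the columns of each matrix $\Phi_j$ are orthogonal.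
   Context: The prime denotes transpose, $\|\cdot\|_2$ is the Euclidean norm, and $\mathrm{card}$ denotes cardinality. Here $\Phi_j\in\mathbb{R}^{n\times m}$, $\phi_0^j\in\mathbb{R}^n$ and $v\in\mathbb{R}^m$. $K$-SVD algorithm. Input: samples $s_1^*,\dots,s_M^*\in\mathbb{R}^n$, number $m$ of basis elements, initial clusters $I_1,\dots,I_K$ with $\bigcup_{j=1}^K I_j=\{1,\dots,M\}$ and $I_i\cap I_j=\emptyset$ for all $i,j=1,\dots,K$, $i\ne j$. Repeat the following two steps until convergence: 1. For $j=1,\dots,K$: set $M_j$ equal to the number of elements of $I_j$; set $\phi_0^j=\frac{1}{M_j}\sum_{i\in I_j}s_i^*$; compute the basis $\Phi_j\in\mathbb{R}^{n\times m}$ using the economy-size singular value decomposition $$S_j=[U_1^j\ \ U_2^j]\begin{bmatrix}\Sigma_1^j&0\\0&\Sigma_2^j\end{bmatrix}[\Phi_j\ \ V_2^j]',$$ where the rows of $S_j$ are $(s_i^*-\phi_0^j)'$, $i\in I_j$, and the singular values are in nonincreasing order, so that the columns of $\Phi_j$ are the right singular vectors associated with the $m$ largest singular values. 2. For $i=1,\dots,M$: reassign $s_i^*$ to the cluster $j$ such that $$j=\arg\min_{j\in\{1,\dots,K\}}\left\{\min_{v}\|s_i^*-\Phi_jv-\phi_0^j\|_2^2\right\}.$$ Output: clusters $I_1,\dots,I_K$, corresponding bases $\Phi_1,\dots,\Phi_K$ of orthogonal vectors, and offset vectors $\phi_0^1,\dots,\phi_0^K$. A termination criterion for the loop is to stop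 when the label vector $J$ does not change after one iteration.
   Formalization: Ties in the arg min of step 2 are restricted: a sample whose current cluster is already a minimizer may only stay or move to a minimizer of smaller index; with arbitrary tie-breaking the algorithm can cycle forever (e.g. collinear samples whose two clusters keep swapping). *)

theory Defs
  imports Complex_Main "HOL-Library.FuncSet" "Jordan_Normal_Form.Matrix"
begin

definition norm2 :: "real vec \<Rightarrow> real" where
  "norm2 x = sqrt (x \<bullet> x)"

text \<open>The value of \<open>min_v \<parallel>x - A v - b\<parallel>\<^sup>2\<close>, with \<open>v\<close> ranging over vectors of length \<open>dim_col A\<close>;
  the infimum is attained, since this is a linear least-squares problem.\<close>

definition residual :: "real vec \<Rightarrow> real mat \<Rightarrow> real vec \<Rightarrow> real" where
  "residual x A b = (INF v \<in> carrier_vec (dim_col A). (norm2 (x - A *\<^sub>v v - b))\<^sup>2)"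

text \<open>Samples, clusters and labels are numbered from 1; matrix and vector entries are numbered
  from 0. Label vectors are extensional functions, so that equality of functions is equality of
  the labels of the samples \<open>1, \<dots>, M\<close>.\<close>

definition label_vectors :: "nat \<Rightarrow> nat \<Rightarrow> (nat \<Rightarrow> nat) set" where
  "label_vectors M K = {1..M} \<rightarrow>\<^sub>E {1..K}"

definition cluster :: "nat \<Rightarrow> (nat \<Rightarrow> nat) \<Rightarrow> nat \<Rightarrow> nat set" where
  "cluster M J j = {i \<in> {1..M}. J i = j}"

definition mean_vec :: "nat \<Rightarrow> (nat \<Rightarrow> real vec) \<Rightarrow> nat set \<Rightarrow> real vec" where
  "mean_vec n s I = (1 / real (card I)) \<cdot>\<^sub>v vec n (\<lambda>a. \<Sum>i\<in>I. s i $ a)"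

definition objective ::
  "nat \<Rightarrow> (nat \<Rightarrow> real vec) \<Rightarrow> (nat \<Rightarrow> nat) \<Rightarrow> (nat \<Rightarrow> real mat) \<Rightarrow> (nat \<Rightarrow> real vec) \<Rightarrow> real" where
  "objective M s J \<Phi> \<phi> = (\<Sum>i = 1..M. residual (s i) (\<Phi> (J i)) (\<phi> (J i)))"

text \<open>The mean of an empty cluster is undefined, so the offset of an empty cluster is left
  unconstrained.\<close>

definition offsets_are_means ::
  "nat \<Rightarrow> nat \<Rightarrow> nat \<Rightarrow> (nat \<Rightarrow> real vec) \<Rightarrow> (nat \<Rightarrow> nat) \<Rightarrow> (nat \<Rightarrow> real vec) \<Rightarrow> bool" where
  "offsets_are_means n M K s J \<phi> \<longleftrightarrow>
     (\<forall>j\<in>{1..K}. \<phi> j \<in> carrier_vec n \<and>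
        (cluster M J j \<noteq> {} \<longrightarrow> \<phi> j = mean_vec n s (cluster M J j)))"

text \<open>The columns of \<open>A\<close> are pairwise orthogonal iff \<open>A\<^sup>T A\<close> is diagonal; they need not be
  normalised.\<close>

definition feasible ::
  "nat \<Rightarrow> nat \<Rightarrow> nat \<Rightarrow> nat \<Rightarrow> (nat \<Rightarrow> real vec) \<Rightarrow>
   (nat \<Rightarrow> nat) \<Rightarrow> (nat \<Rightarrow> real mat) \<Rightarrow> (nat \<Rightarrow> real vec) \<Rightarrow> bool" where
  "feasible n m M K s J \<Phi> \<phi> \<longleftrightarrow>
     J \<in> label_vectors M K \<and> offsets_are_means n M K s J \<phi> \<and>
     (\<forall>j\<in>{1..K}. \<Phi> j \<in> carrier_mat n m \<and> diagonal_mat (transpose_mat (\<Phi> j) * \<Phi> j))"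

text \<open>Local minimality refers to the product of the discrete topology on label vectors and the
  Euclidean topology on the bases and offsets: every neighbourhood of a point contains one in which
  the labels agree with those of the point.\<close>

definition local_minimum ::
  "nat \<Rightarrow> nat \<Rightarrow> nat \<Rightarrow> nat \<Rightarrow> (nat \<Rightarrow> real vec) \<Rightarrow>
   (nat \<Rightarrow> nat) \<Rightarrow> (nat \<Rightarrow> real mat) \<Rightarrow> (nat \<Rightarrow> real vec) \<Rightarrow> bool" where
  "local_minimum n m M K s J \<Phi> \<phi> \<longleftrightarrow>
     feasible n m M K s J \<Phi> \<phi> \<and>
     (\<exists>\<epsilon>>0. \<forall>J' \<Phi>' \<phi>'.
        feasible n m M K s J' \<Phi>' \<phi>' \<and> J' = J \<and>
        (\<forall>j\<in>{1..K}. \<forall>a<n. \<bar>\<phi>' j $ a - \<phi> j $ a\<bar> < \<epsilon> \<and>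
           (\<forall>b<m. \<bar>\<Phi>' j $$ (a, b) - \<Phi> j $$ (a, b)\<bar> < \<epsilon>))
        \<longrightarrow> objective M s J \<Phi> \<phi> \<le> objective M s J' \<Phi>' \<phi>')"

definition economy_svd :: "real mat \<Rightarrow> real mat \<Rightarrow> real mat \<Rightarrow> real mat \<Rightarrow> bool" where
  "economy_svd S U D V \<longleftrightarrow>
     (let r = min (dim_row S) (dim_col S) in
        U \<in> carrier_mat (dim_row S) r \<and> D \<in> carrier_mat r r \<and> V \<in> carrier_mat (dim_col S) r \<and>
        transpose_mat U * U = 1\<^sub>m r \<and> transpose_mat V * V = 1\<^sub>m r \<and>
        diagonal_mat D \<and> (\<forall>k<r. 0 \<le> D $$ (k, k)) \<and>
        (\<forall>k l. k \<le> l \<and> l < r \<longrightarrow> D $$ (l, l) \<le> D $$ (k, k)) \<and>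
        S = U * D * transpose_mat V)"

text \<open>\<open>B\<close> consists of the first \<open>m\<close> columns of \<open>V\<close>. If \<open>S\<close> has fewer than \<open>m\<close> rows, an economy-size
  decomposition has fewer than \<open>m\<close> right singular vectors; these are then completed to \<open>m\<close>
  orthonormal columns in an arbitrary way.\<close>

definition svd_basis :: "nat \<Rightarrow> real mat \<Rightarrow> real mat \<Rightarrow> bool" where
  "svd_basis m S B \<longleftrightarrow>
     B \<in> carrier_mat (dim_col S) m \<and> transpose_mat B * B = 1\<^sub>m m \<and>
     (\<exists>U D V. economy_svd S U D V \<and> (\<forall>k < min m (dim_col V). col B k = col V k))"

definition centered_mat ::
  "nat \<Rightarrow> nat \<Rightarrow> (nat \<Rightarrow> real vec) \<Rightarrow> (nat \<Rightarrow> nat) \<Rightarrow> (nat \<Rightarrow> real vec) \<Rightarrow> nat \<Rightarrow> real mat" where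
  "centered_mat n M s J \<phi> j =
     mat_of_rows n (map (\<lambda>i. s i - \<phi> j) (sorted_list_of_set (cluster M J j)))"

definition fit_step ::
  "nat \<Rightarrow> nat \<Rightarrow> nat \<Rightarrow> nat \<Rightarrow> (nat \<Rightarrow> real vec) \<Rightarrow>
   (nat \<Rightarrow> nat) \<Rightarrow> (nat \<Rightarrow> real mat) \<Rightarrow> (nat \<Rightarrow> real vec) \<Rightarrow> bool" where
  "fit_step n m M K s J \<Phi> \<phi> \<longleftrightarrow>
     offsets_are_means n M K s J \<phi> \<and>
     (\<forall>j\<in>{1..K}. svd_basis m (centered_mat n M s J \<phi> j) (\<Phi> j))"

definition best_label ::
  "nat \<Rightarrow> (nat \<Rightarrow> real mat) \<Rightarrow> (nat \<Rightarrow> real vec) \<Rightarrow> real vec \<Rightarrow> nat \<Rightarrow> bool" where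
  "best_label K \<Phi> \<phi> x = is_arg_min (\<lambda>j. residual x (\<Phi> j) (\<phi> j)) (\<lambda>j. j \<in> {1..K})"

text \<open>The arg min need not be unique. With arbitrary tie-breaking the iteration may cycle: if all
  samples lie on one line and two clusters with the same fitted line swap their samples, nothing
  but the labels changes. So a sample whose present label is a minimiser may only keep that label
  or move to a minimiser of smaller index. Both usual rules (take the least minimiser; move only
  if the residual strictly decreases) satisfy this.\<close>

definition assign_step ::
  "nat \<Rightarrow> nat \<Rightarrow> (nat \<Rightarrow> real vec) \<Rightarrow> (nat \<Rightarrow> real mat) \<Rightarrow> (nat \<Rightarrow> real vec) \<Rightarrow>
   (nat \<Rightarrow> nat) \<Rightarrow> (nat \<Rightarrow> nat) \<Rightarrow> bool" where
  "assign_step M K s \<Phi> \<phi> J J' \<longleftrightarrow>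
     J' \<in> label_vectors M K \<and>
     (\<forall>i\<in>{1..M}. best_label K \<Phi> \<phi> (s i) (J' i) \<and>
        (best_label K \<Phi> \<phi> (s i) (J i) \<longrightarrow> J' i \<le> J i))"

text \<open>\<open>J t\<close> are the labels before iteration \<open>t\<close>, and \<open>\<Phi> t\<close>, \<open>\<phi> t\<close> are the bases and offsets
  computed from them in iteration \<open>t\<close>. The loop is continued indefinitely; stopping criteria are
  properties of the resulting sequence. Any choice among the singular value decompositions is
  allowed, in every iteration anew.\<close>

definition ksvd_run ::
  "nat \<Rightarrow> nat \<Rightarrow> nat \<Rightarrow> nat \<Rightarrow> (nat \<Rightarrow> real vec) \<Rightarrow> (nat \<Rightarrow> nat set) \<Rightarrow>
   (nat \<Rightarrow> nat \<Rightarrow> nat) \<Rightarrow> (nat \<Rightarrow> nat \<Rightarrow> real mat) \<Rightarrow> (nat \<Rightarrow> nat \<Rightarrow> real vec) \<Rightarrow> bool" where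
  "ksvd_run n m M K s I\<^sub>0 J \<Phi> \<phi> \<longleftrightarrow>
     J 0 \<in> label_vectors M K \<and> (\<forall>j\<in>{1..K}. cluster M (J 0) j = I\<^sub>0 j) \<and>
     (\<forall>t. fit_step n m M K s (J t) (\<Phi> t) (\<phi> t) \<and>
          assign_step M K s (\<Phi> t) (\<phi> t) (J t) (J (Suc t)))"

end

theory Submission
  imports Defs
begin

text \<open>The residual of \<open>x\<close> with respect to an affine subspace is a positive semidefinite quadratic
  form in \<open>x - b\<close>, so for a fixed basis the mean is the best offset. For a matrix \<open>S\<close> with
  singular values \<open>\<sigma>\<^sub>k\<close> and right singular vectors \<open>v\<^sub>k\<close>, the part of the squared norm captured by
  orthonormal vectors \<open>q\<^sub>l\<close> is \<open>\<Sum>\<^sub>l |S q\<^sub>l|\<^sup>2 = \<Sum>\<^sub>k \<sigma>\<^sub>k\<^sup>2 w\<^sub>k\<close> with \<open>w\<^sub>k = \<Sum>\<^sub>l (v\<^sub>k \<bullet> q\<^sub>l)\<^sup>2\<close>. Bessel's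
  inequality, used once for the \<open>q\<^sub>l\<close> and once for the \<open>v\<^sub>k\<close>, gives \<open>w\<^sub>k \<le> 1\<close> and \<open>\<Sum>\<^sub>k w\<^sub>k \<le> m\<close>, hence
  at most \<open>\<sigma>\<^sub>0\<^sup>2 + \<dots> + \<sigma>\<^bsub>m-1\<^esub>\<^sup>2\<close> is captured. So the fitting step is globally optimal for the current
  labels, the objective after fitting depends only on the labels and never increases, and hence it
  is eventually constant. From then on reassignment only breaks ties, so labels can only decrease,
  and they stabilise.\<close>

section \<open>Least squares over orthogonal columns\<close>

lemma scalar_prod_self_nonneg: "0 \<le> x \<bullet> (x :: real vec)"
  by (auto simp: scalar_prod_def intro!: sum_nonneg)

lemma norm2_square: "(norm2 x)\<^sup>2 = x \<bullet> x"
  by (simp add: norm2_def scalar_prod_self_nonneg)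

text \<open>Orthogonal columns may vanish; a zero column is orthogonal to every vector and so does
  no harm in formulas that divide by \<open>col A l \<bullet> col A l\<close>.\<close>

lemma scalar_prod_self_eq_0_D:
  fixes x :: "real vec"
  assumes "x \<bullet> x = 0" "x \<in> carrier_vec n" "y \<in> carrier_vec n"
  shows "x \<bullet> y = 0"
proof -
  have "\<forall>i\<in>{0..<n}. x $ i * x $ i = 0"
    using assms(1,2) unfolding scalar_prod_def
    by (subst sum_nonneg_eq_0_iff[symmetric]) auto
  then show ?thesis
    using assms(2,3) by (auto simp: scalar_prod_def)
qed

lemma diagonal_gram_col_orthogonal:
  assumes "A \<in> carrier_mat n m" "diagonal_mat (transpose_mat A * A)" "k < m" "l < m" "k \<noteq> l"
  shows "col A k \<bullet> col A l = 0"
proof -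
  have "(transpose_mat A * A) $$ (k, l) = 0"
    using assms by (auto simp: diagonal_mat_def)
  then show ?thesis
    using assms by simp
qed

lemma mult_mat_vec_scalar_prod:
  fixes A :: "real mat"
  assumes "A \<in> carrier_mat n m" "w \<in> carrier_vec m" "y \<in> carrier_vec n"
  shows "y \<bullet> (A *\<^sub>v w) = (\<Sum>l<m. (col A l \<bullet> y) * w $ l)"
proof -
  have "y \<bullet> (A *\<^sub>v w) = (transpose_mat A *\<^sub>v y) \<bullet> w"
    using transpose_vec_mult_scalar assms by metis
  also have "\<dots> = (\<Sum>l<m. (col A l \<bullet> y) * w $ l)"
    using assms by (auto simp: scalar_prod_def[of _ w] lessThan_atLeast0 intro!: sum.cong)
  finally show ?thesis .
qed

text \<open>Orthogonality removes the mixed products, so the squared distance decouples into one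
  quadratic polynomial per coordinate of \<open>w\<close>.\<close>

lemma square_distance_expand:
  fixes A :: "real mat"
  assumes A: "A \<in> carrier_mat n m" and diag: "diagonal_mat (transpose_mat A * A)"
    and w: "w \<in> carrier_vec m" and y: "y \<in> carrier_vec n"
  shows "(y - A *\<^sub>v w) \<bullet> (y - A *\<^sub>v w) =
    y \<bullet> y + (\<Sum>l<m. (col A l \<bullet> col A l) * (w $ l)\<^sup>2 - 2 * (col A l \<bullet> y) * w $ l)"
proof -
  let ?z = "A *\<^sub>v w"
  have z: "?z \<in> carrier_vec n" using A w by simp
  have "col A l \<bullet> ?z = (col A l \<bullet> col A l) * w $ l" if "l < m" for l
  proof -
    have c: "col A l \<in> carrier_vec n" using A by auto
    have "col A l \<bullet> ?z = (\<Sum>k<m. (col A k \<bullet> col A l) * w $ k)"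
      by (rule mult_mat_vec_scalar_prod[OF A w c])
    also have "\<dots> = (\<Sum>k<m. if k = l then (col A l \<bullet> col A l) * w $ l else 0)"
      using diagonal_gram_col_orthogonal[OF A diag] that by (intro sum.cong) auto
    finally show ?thesis using that by simp
  qed
  then have zz: "?z \<bullet> ?z = (\<Sum>l<m. (col A l \<bullet> col A l) * (w $ l)\<^sup>2)"
    using mult_mat_vec_scalar_prod[OF A w z] by (simp add: power2_eq_square mult.assoc)
  have "(y - ?z) \<bullet> (y - ?z) = y \<bullet> y - 2 * (y \<bullet> ?z) + ?z \<bullet> ?z"
    using y z comm_scalar_prod[OF y z]
    by (simp add: minus_scalar_prod_distrib[of _ n] scalar_prod_minus_distrib[of _ n])
  then show ?thesis
    unfolding zz mult_mat_vec_scalar_prod[OF A w y]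
    by (simp add: sum_subtractf sum_distrib_left algebra_simps)
qed

text \<open>The bilinear form of the projection onto the orthogonal complement of the columns of \<open>A\<close>,
  provided these are orthogonal. A zero column contributes nothing, since \<open>0 / 0 = 0\<close>.\<close>

definition defect :: "real mat \<Rightarrow> real vec \<Rightarrow> real vec \<Rightarrow> real" where
  "defect A y z = y \<bullet> z - (\<Sum>l<dim_col A. (col A l \<bullet> y) * (col A l \<bullet> z) / (col A l \<bullet> col A l))"

text \<open>Each of the decoupled quadratics is bounded below by completing the square.\<close>

lemma defect_le_square_distance:
  fixes A :: "real mat"
  assumes A: "A \<in> carrier_mat n m" and diag: "diagonal_mat (transpose_mat A * A)"
    and w: "w \<in> carrier_vec m" and y: "y \<in> carrier_vec n"
  shows "defect A y y \<le> (y - A *\<^sub>v w) \<bullet> (y - A *\<^sub>v w)"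
proof -
  have "- ((col A l \<bullet> y) * (col A l \<bullet> y) / (col A l \<bullet> col A l))
      \<le> (col A l \<bullet> col A l) * (w $ l)\<^sup>2 - 2 * (col A l \<bullet> y) * w $ l" if "l < m" for l
  proof (cases "col A l \<bullet> col A l = 0")
    case True
    \<comment> \<open>For a zero column both coefficients on the right vanish, and so does the
      quotient on the left.\<close>
    then have "col A l \<bullet> y = 0"
      using scalar_prod_self_eq_0_D A y by (metis carrier_matD(1) col_dim)
    with True show ?thesis by simp
  next
    case False
    define g where "g = col A l \<bullet> col A l"
    define c where "c = col A l \<bullet> y"
    have "g > 0"
      using False scalar_prod_self_nonneg[of "col A l"] unfolding g_def by linarith
    then have "g * (w $ l)\<^sup>2 - 2 * c * w $ l + c * c / g = (g * w $ l - c)\<^sup>2 / g"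
      by (simp add: field_simps power2_eq_square)
    moreover have "(g * w $ l - c)\<^sup>2 / g \<ge> 0"
      using \<open>g > 0\<close> by simp
    ultimately show ?thesis
      unfolding g_def[symmetric] c_def[symmetric] by linarith
  qed
  then have "(\<Sum>l<m. - ((col A l \<bullet> y) * (col A l \<bullet> y) / (col A l \<bullet> col A l)))
      \<le> (\<Sum>l<m. (col A l \<bullet> col A l) * (w $ l)\<^sup>2 - 2 * (col A l \<bullet> y) * w $ l)"
    by (intro sum_mono) auto
  then show ?thesis
    using A unfolding square_distance_expand[OF A diag w y] defect_def
    by (simp add: sum_negf)
qed

lemma defect_attained:
  fixes A :: "real mat"
  assumes A: "A \<in> carrier_mat n m" and diag: "diagonal_mat (transpose_mat A * A)"
    and y: "y \<in> carrier_vec n"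
  obtains w where "w \<in> carrier_vec m" "(y - A *\<^sub>v w) \<bullet> (y - A *\<^sub>v w) = defect A y y"
proof
  \<comment> \<open>The vertices of the decoupled quadratics, that is, the least-squares
    coefficients; a zero column gets coefficient 0.\<close>
  define w where "w = vec m (\<lambda>l. (col A l \<bullet> y) / (col A l \<bullet> col A l))"
  show w: "w \<in> carrier_vec m" by (simp add: w_def)
  have "(\<Sum>l<m. (col A l \<bullet> col A l) * (w $ l)\<^sup>2 - 2 * (col A l \<bullet> y) * w $ l)
      = (\<Sum>l<m. - ((col A l \<bullet> y) * (col A l \<bullet> y) / (col A l \<bullet> col A l)))"
    by (intro sum.cong) (auto simp: w_def field_simps power2_eq_square)
  then show "(y - A *\<^sub>v w) \<bullet> (y - A *\<^sub>v w) = defect A y y"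
    using A unfolding square_distance_expand[OF A diag w y] defect_def
    by (simp add: sum_negf)
qed

lemma defect_nonneg:
  assumes "A \<in> carrier_mat n m" "diagonal_mat (transpose_mat A * A)" "y \<in> carrier_vec n"
  shows "0 \<le> defect A y y"
  using defect_attained[OF assms] scalar_prod_self_nonneg by metis

text \<open>The defect is a lower bound that is attained, so the infimum is a minimum and has a
  closed form.\<close>

lemma residual_eq_defect:
  assumes A: "A \<in> carrier_mat n m" and diag: "diagonal_mat (transpose_mat A * A)"
    and x: "x \<in> carrier_vec n" and b: "b \<in> carrier_vec n"
  shows "residual x A b = defect A (x - b) (x - b)"
proof -
  have y: "x - b \<in> carrier_vec n" using x b by simp
  have eq: "(norm2 (x - A *\<^sub>v v - b))\<^sup>2 = (x - b - A *\<^sub>v v) \<bullet> (x - b - A *\<^sub>v v)"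
    if "v \<in> carrier_vec m" for v
  proof -
    have "x - A *\<^sub>v v - b = x - b - A *\<^sub>v v"
      using x b A that by (intro eq_vecI) auto
    then show ?thesis by (simp add: norm2_square)
  qed
  obtain w where w: "w \<in> carrier_vec m"
    "(x - b - A *\<^sub>v w) \<bullet> (x - b - A *\<^sub>v w) = defect A (x - b) (x - b)"
    using defect_attained[OF A diag y] .
  have "(INF v \<in> carrier_vec m. (norm2 (x - A *\<^sub>v v - b))\<^sup>2) = defect A (x - b) (x - b)"
  proof (rule cInf_eq_minimum)
    show "defect A (x - b) (x - b) \<in> (\<lambda>v. (norm2 (x - A *\<^sub>v v - b))\<^sup>2) ` carrier_vec m"
      using w eq[OF w(1)] by (intro image_eqI[of _ _ w]) auto
  qed (use eq defect_le_square_distance[OF A diag _ y] in auto)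
  then show ?thesis using A by (simp add: residual_def)
qed

section \<open>Bessel's inequality and a bound for weighted sums\<close>

lemma orthonormal_col_unit:
  fixes V :: "real mat"
  assumes "V \<in> carrier_mat n r" "transpose_mat V * V = 1\<^sub>m r" "k < r"
  shows "col V k \<bullet> col V k = 1"
proof -
  have "(transpose_mat V * V) $$ (k, k) = 1" using assms by simp
  then show ?thesis using assms(1,3) by simp
qed

lemma diagonal_mat_one: "diagonal_mat (1\<^sub>m m)"
  by (auto simp: diagonal_mat_def)

text \<open>For unit columns all denominators in \<open>defect V y y\<close> are 1, and its
  nonnegativity is Bessel's inequality.\<close>

lemma bessel_orthonormal:
  fixes V :: "real mat"
  assumes V: "V \<in> carrier_mat n r" and orth: "transpose_mat V * V = 1\<^sub>m r"
    and y: "y \<in> carrier_vec n"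
  shows "(\<Sum>k<r. (col V k \<bullet> y)\<^sup>2) \<le> y \<bullet> y"
  using defect_nonneg[OF V _ y] V orthonormal_col_unit[OF V orth]
  by (simp add: defect_def power2_eq_square orth diagonal_mat_one)

text \<open>If \<open>m < r\<close>, subtract the threshold \<open>c m\<close> from all
  coefficients: terms from index \<open>m\<close> on become nonpositive, earlier ones are at most
  \<open>c k - c m\<close> because \<open>w k \<le> 1\<close>, and the weighted sum loses at most
  \<open>c m * real m\<close>.\<close>

lemma sum_weighted_le_sum_initial:
  fixes c w :: "nat \<Rightarrow> real"
  assumes anti: "\<And>k l. k \<le> l \<Longrightarrow> l < r \<Longrightarrow> c l \<le> c k"
    and nonneg: "\<And>k. k < r \<Longrightarrow> 0 \<le> c k"
    and w: "\<And>k. k < r \<Longrightarrow> 0 \<le> w k" "\<And>k. k < r \<Longrightarrow> w k \<le> 1" "(\<Sum>k<r. w k) \<le> real m"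
  shows "(\<Sum>k<r. c k * w k) \<le> (\<Sum>k<min m r. c k)"
proof (cases "r \<le> m")
  case True
  have "(\<Sum>k<r. c k * w k) \<le> (\<Sum>k<r. c k * 1)"
    using nonneg w by (intro sum_mono mult_left_mono) auto
  then show ?thesis using True by (simp add: min_absorb2)
next
  case False
  then have m: "m < r" by simp
  have "(\<Sum>k<r. (c k - c m) * w k) \<le> (\<Sum>k<r. if k < m then c k - c m else 0)"
  proof (intro sum_mono)
    fix k assume k: "k \<in> {..<r}"
    show "(c k - c m) * w k \<le> (if k < m then c k - c m else 0)"
    proof (cases "k < m")
      case True
      then have "c m \<le> c k" using anti m by simp
      then show ?thesis using True k w mult_left_mono[of "w k" 1 "c k - c m"] by simp
    next
      case False
      then have "c k \<le> c m" using anti k by simp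
      then show ?thesis using False k w by (simp add: mult_nonpos_nonneg)
    qed
  qed
  also have "\<dots> = (\<Sum>k<m. c k - c m)"
    using m by (intro sum.mono_neutral_cong_right) auto
  also have "\<dots> = (\<Sum>k<m. c k) - c m * real m"
    by (simp add: sum_subtractf)
  also have "(\<Sum>k<r. (c k - c m) * w k) = (\<Sum>k<r. c k * w k) - c m * (\<Sum>k<r. w k)"
    by (simp add: left_diff_distrib sum_subtractf sum_distrib_left)
  finally have "(\<Sum>k<r. c k * w k) - c m * (\<Sum>k<r. w k) \<le> (\<Sum>k<m. c k) - c m * real m" .
  moreover have "c m * (\<Sum>k<r. w k) \<le> c m * real m"
    using nonneg m w by (intro mult_left_mono) auto
  ultimately show ?thesis using m by (simp add: min_absorb1)
qed

section \<open>Optimality of the leading right singular vectors\<close>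

text \<open>The orthonormal columns of \<open>U\<close> preserve the norm of
  \<open>D *\<^sub>v (transpose_mat V *\<^sub>v q)\<close>, whose entries are explicit because
  \<open>D\<close> is diagonal.\<close>

lemma economy_svd_quadratic_form:
  assumes svd: "economy_svd S U D V" and q: "q \<in> carrier_vec (dim_col S)"
  shows "(S *\<^sub>v q) \<bullet> (S *\<^sub>v q) = (\<Sum>k<dim_col V. (D $$ (k, k))\<^sup>2 * (col V k \<bullet> q)\<^sup>2)"
proof -
  define N n r where "N = dim_row S" and "n = dim_col S" and "r = min N n"
  have U: "U \<in> carrier_mat N r" and D: "D \<in> carrier_mat r r"
    and V: "V \<in> carrier_mat n r" and orth: "transpose_mat U * U = 1\<^sub>m r"
    and diag: "diagonal_mat D" and S: "S = U * D * transpose_mat V"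
    using svd unfolding economy_svd_def Let_def N_def n_def r_def by blast+
  have q: "q \<in> carrier_vec n" using q by (simp add: n_def)
  define y where "y = D *\<^sub>v (transpose_mat V *\<^sub>v q)"
  have Vq: "transpose_mat V *\<^sub>v q \<in> carrier_vec r" and VT: "transpose_mat V \<in> carrier_mat r n"
    using V q by auto
  then have y: "y \<in> carrier_vec r" using D by (simp add: y_def)
  have "S *\<^sub>v q = (U * D) *\<^sub>v (transpose_mat V *\<^sub>v q)"
    unfolding S using U D VT q by (intro assoc_mult_mat_vec) auto
  also have "\<dots> = U *\<^sub>v y"
    unfolding y_def using U D Vq by (rule assoc_mult_mat_vec)
  finally have Sq: "S *\<^sub>v q = U *\<^sub>v y" .
  have "(S *\<^sub>v q) \<bullet> (S *\<^sub>v q) = (transpose_mat U *\<^sub>v (U *\<^sub>v y)) \<bullet> y"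
    unfolding Sq using U y by (intro transpose_vec_mult_scalar[symmetric]) auto
  also have "transpose_mat U *\<^sub>v (U *\<^sub>v y) = y"
  proof -
    have "transpose_mat U *\<^sub>v (U *\<^sub>v y) = (transpose_mat U * U) *\<^sub>v y"
      using U y by (intro assoc_mult_mat_vec[symmetric]) auto
    then show ?thesis using y by (simp add: orth)
  qed
  also have "y \<bullet> y = (\<Sum>k<r. (D $$ (k, k))\<^sup>2 * (col V k \<bullet> q)\<^sup>2)"
  proof -
    have "y $ k = D $$ (k, k) * (col V k \<bullet> q)" if k: "k < r" for k
    proof -
      have "y $ k = (\<Sum>l = 0..<r. D $$ (k, l) * (col V l \<bullet> q))"
        using k D V q by (simp add: y_def scalar_prod_def[of "row D k"])
      also have "\<dots> = (\<Sum>l = 0..<r. if l = k then D $$ (k, k) * (col V k \<bullet> q) else 0)"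
        using diag D k by (intro sum.cong) (auto simp: diagonal_mat_def)
      finally show ?thesis using k by simp
    qed
    then show ?thesis
      using y by (auto simp: scalar_prod_def[of y] lessThan_atLeast0 power2_eq_square intro!: sum.cong)
  qed
  finally show ?thesis using V by simp
qed

lemma square_mult_mat_vec:
  fixes S :: "real mat"
  shows "(S *\<^sub>v q) \<bullet> (S *\<^sub>v q) = (\<Sum>i<dim_row S. (row S i \<bullet> q)\<^sup>2)"
  by (auto simp: scalar_prod_def[of "S *\<^sub>v q"] lessThan_atLeast0 power2_eq_square intro!: sum.cong)

text \<open>Exchanging the sums over rows and columns shows that minimising the total defect amounts
  to maximising the captured part of the squared norm.\<close>

lemma sum_defect_rows:
  fixes S :: "real mat"
  assumes S: "S \<in> carrier_mat N n" and A: "A \<in> carrier_mat n m"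
  shows "(\<Sum>i<N. defect A (row S i) (row S i)) = (\<Sum>i<N. row S i \<bullet> row S i)
    - (\<Sum>l<m. ((S *\<^sub>v col A l) \<bullet> (S *\<^sub>v col A l)) / (col A l \<bullet> col A l))"
proof -
  have "(\<Sum>i<N. \<Sum>l<m. (col A l \<bullet> row S i) * (col A l \<bullet> row S i) / (col A l \<bullet> col A l))
      = (\<Sum>l<m. \<Sum>i<N. (row S i \<bullet> col A l)\<^sup>2 / (col A l \<bullet> col A l))"
    using S A comm_scalar_prod[of "col A _" n "row S _"]
    by (subst sum.swap) (auto simp: power2_eq_square intro!: sum.cong)
  also have "\<dots> = (\<Sum>l<m. ((S *\<^sub>v col A l) \<bullet> (S *\<^sub>v col A l)) / (col A l \<bullet> col A l))"
    using S by (simp add: square_mult_mat_vec sum_divide_distrib)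
  finally show ?thesis
    using A by (simp add: defect_def sum_subtractf)
qed

text \<open>The sum of the leading \<open>min m r\<close> squared singular values separates what
  \<open>A\<close> captures from what \<open>B\<close> captures. Columns of \<open>B\<close> that
  merely complete the basis can only capture more.\<close>

lemma svd_basis_min_sum_defect:
  assumes S: "S \<in> carrier_mat N n" and basis: "svd_basis m S B"
    and A: "A \<in> carrier_mat n m" and diag: "diagonal_mat (transpose_mat A * A)"
  shows "(\<Sum>i<N. defect B (row S i) (row S i)) \<le> (\<Sum>i<N. defect A (row S i) (row S i))"
proof -
  obtain U D V where svd: "economy_svd S U D V"
    and BV: "\<forall>k < min m (dim_col V). col B k = col V k"
    and B: "B \<in> carrier_mat n m" and B_orth: "transpose_mat B * B = 1\<^sub>m m"
    using basis S unfolding svd_basis_def by auto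
  define r where "r = min N n"
  have dims: "dim_row S = N" "dim_col S = n" using S by auto
  have V: "V \<in> carrier_mat n r" and V_orth: "transpose_mat V * V = 1\<^sub>m r"
    and D_nonneg: "\<forall>k<r. 0 \<le> D $$ (k, k)"
    and D_anti: "\<forall>k l. k \<le> l \<and> l < r \<longrightarrow> D $$ (l, l) \<le> D $$ (k, k)"
    using svd unfolding economy_svd_def Let_def dims r_def by blast+
  define c where "c k = (D $$ (k, k))\<^sup>2" for k
  have form: "(S *\<^sub>v q) \<bullet> (S *\<^sub>v q) = (\<Sum>k<r. c k * (col V k \<bullet> q)\<^sup>2)" if "q \<in> carrier_vec n" for q
    using economy_svd_quadratic_form[OF svd] that V dims by (simp add: c_def)
  \<comment> \<open>The columns of \<open>A\<close> are normalised here; a zero column contributes 0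
    to every weight.\<close>
  define w where "w k = (\<Sum>l<m. (col V k \<bullet> col A l)\<^sup>2 / (col A l \<bullet> col A l))" for k
  have colA: "col A l \<in> carrier_vec n" for l using A by auto
  have colV: "col V k \<in> carrier_vec n" for k using V by auto
  have "(\<Sum>l<m. ((S *\<^sub>v col A l) \<bullet> (S *\<^sub>v col A l)) / (col A l \<bullet> col A l))
      = (\<Sum>l<m. \<Sum>k<r. c k * ((col V k \<bullet> col A l)\<^sup>2 / (col A l \<bullet> col A l)))"
    by (simp add: form[OF colA] sum_divide_distrib)
  also have "\<dots> = (\<Sum>k<r. c k * w k)"
    by (subst sum.swap) (simp add: w_def sum_distrib_left)
  also have "\<dots> \<le> (\<Sum>k<min m r. c k)"
  proof (rule sum_weighted_le_sum_initial)
    fix k l assume "k \<le> l" "l < r"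
    then show "c l \<le> c k"
      unfolding c_def using D_anti D_nonneg by (intro power_mono) auto
  next
    fix k assume k: "k < r"
    \<comment> \<open>Bessel's inequality for the orthogonal columns of \<open>A\<close>, applied to
      the unit vector \<open>col V k\<close>.\<close>
    show "w k \<le> 1"
      using defect_nonneg[OF A diag colV[of k]] orthonormal_col_unit[OF V V_orth k] A
        comm_scalar_prod[OF colA colV]
      by (simp add: defect_def w_def power2_eq_square)
  next
    have "(\<Sum>k<r. w k) = (\<Sum>l<m. (\<Sum>k<r. (col V k \<bullet> col A l)\<^sup>2) / (col A l \<bullet> col A l))"
      unfolding w_def by (subst sum.swap) (simp add: sum_divide_distrib)
    also have "\<dots> \<le> (\<Sum>l<m. 1)"
    proof (rule sum_mono)
      fix l
      \<comment> \<open>Bessel's inequality for \<open>V\<close>, applied to a column of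
        \<open>A\<close>; for a zero column the quotient is 0.\<close>
      show "(\<Sum>k<r. (col V k \<bullet> col A l)\<^sup>2) / (col A l \<bullet> col A l) \<le> 1"
        using bessel_orthonormal[OF V V_orth colA[of l]] scalar_prod_self_nonneg[of "col A l"]
        unfolding divide_le_eq_1 by linarith
    qed
    finally show "(\<Sum>k<r. w k) \<le> real m" by simp
  qed (auto simp: c_def w_def scalar_prod_self_nonneg intro!: sum_nonneg divide_nonneg_nonneg)
  also have "\<dots> \<le> (\<Sum>l<min m r. (S *\<^sub>v col B l) \<bullet> (S *\<^sub>v col B l))"
  proof (intro sum_mono)
    fix l assume "l \<in> {..<min m r}"
    then have l: "l < r" "col B l = col V l" using BV V by auto
    have "c l = c l * (col V l \<bullet> col V l)\<^sup>2"
      using orthonormal_col_unit[OF V V_orth l(1)] by simp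
    \<comment> \<open>A single nonnegative summand, the one with \<open>k = l\<close>, already gives
      the bound.\<close>
    also have "\<dots> \<le> (\<Sum>k<r. c k * (col V k \<bullet> col V l)\<^sup>2)"
      using l(1) by (intro member_le_sum) (auto simp: c_def)
    finally show "c l \<le> (S *\<^sub>v col B l) \<bullet> (S *\<^sub>v col B l)"
      by (simp add: l(2) form[OF colV])
  qed
  also have "\<dots> \<le> (\<Sum>l<m. (S *\<^sub>v col B l) \<bullet> (S *\<^sub>v col B l))"
    by (intro sum_mono2) (auto simp: scalar_prod_self_nonneg)
  also have "\<dots> = (\<Sum>l<m. ((S *\<^sub>v col B l) \<bullet> (S *\<^sub>v col B l)) / (col B l \<bullet> col B l))"
    using orthonormal_col_unit[OF B B_orth] by simp
  finally show ?thesis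
    unfolding sum_defect_rows[OF S A] sum_defect_rows[OF S B] by simp
qed

section \<open>Optimality of the mean as offset\<close>

lemma defect_add_square:
  assumes A: "A \<in> carrier_mat n m" and y: "y \<in> carrier_vec n" and d: "d \<in> carrier_vec n"
  shows "defect A (y + d) (y + d) = defect A y y + 2 * defect A y d + defect A d d"
proof -
  have "col A l \<bullet> (y + d) = col A l \<bullet> y + col A l \<bullet> d" for l
    using A y d by (intro scalar_prod_add_distrib[of _ n]) auto
  moreover have "(y + d) \<bullet> (y + d) = y \<bullet> y + 2 * (y \<bullet> d) + d \<bullet> d"
    using y d comm_scalar_prod[OF y d]
    by (simp add: scalar_prod_add_distrib[of _ n] add_scalar_prod_distrib[of _ n])
  ultimately show ?thesis
    by (simp add: defect_def algebra_simps add_divide_distrib sum.distrib sum_distrib_left)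
qed

lemma mean_vec_carrier [simp]: "mean_vec n s I \<in> carrier_vec n"
  by (simp add: mean_vec_def)

lemma dim_mean_vec [simp]: "dim_vec (mean_vec n s I) = n"
  by (simp add: mean_vec_def)

text \<open>In each coordinate the deviations from the mean cancel.\<close>

lemma sum_scalar_prod_centered:
  assumes "finite I" "I \<noteq> {}" and s: "\<And>i. i \<in> I \<Longrightarrow> s i \<in> carrier_vec n" and c: "c \<in> carrier_vec n"
  shows "(\<Sum>i\<in>I. c \<bullet> (s i - mean_vec n s I)) = 0"
proof -
  let ?\<mu> = "mean_vec n s I"
  have "(\<Sum>i\<in>I. c \<bullet> (s i - ?\<mu>)) = (\<Sum>i\<in>I. \<Sum>a<n. c $ a * (s i $ a - ?\<mu> $ a))"
    using s c by (intro sum.cong) (auto simp: scalar_prod_def lessThan_atLeast0 mean_vec_def)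
  also have "\<dots> = (\<Sum>a<n. c $ a * (\<Sum>i\<in>I. s i $ a - ?\<mu> $ a))"
    by (subst sum.swap) (simp add: sum_distrib_left)
  also have "\<dots> = 0"
    using assms(1,2) by (intro sum.neutral) (auto simp: sum_subtractf mean_vec_def)
  finally show ?thesis .
qed

text \<open>Parallel axis argument: moving the offset away from the mean by \<open>d\<close>
  produces a cross term linear in the deviations, which vanishes, and \<open>card I\<close> copies
  of the nonnegative \<open>defect A d d\<close>.\<close>

lemma mean_min_sum_defect:
  assumes I: "finite I" "I \<noteq> {}" and s: "\<And>i. i \<in> I \<Longrightarrow> s i \<in> carrier_vec n"
    and A: "A \<in> carrier_mat n m" and diag: "diagonal_mat (transpose_mat A * A)"
    and b: "b \<in> carrier_vec n"
  shows "(\<Sum>i\<in>I. defect A (s i - mean_vec n s I) (s i - mean_vec n s I))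
    \<le> (\<Sum>i\<in>I. defect A (s i - b) (s i - b))"
proof -
  let ?\<mu> = "mean_vec n s I"
  define d where "d = ?\<mu> - b"
  have d: "d \<in> carrier_vec n" using b by (simp add: d_def)
  have shift: "s i - b = (s i - ?\<mu>) + d" if "i \<in> I" for i
    using s[OF that] b unfolding d_def by (intro eq_vecI) auto
  have cross: "(\<Sum>i\<in>I. defect A (s i - ?\<mu>) d) = 0"
  proof -
    have "(\<Sum>i\<in>I. (s i - ?\<mu>) \<bullet> d) = (\<Sum>i\<in>I. d \<bullet> (s i - ?\<mu>))"
      using s d by (intro sum.cong comm_scalar_prod[of _ n]) auto
    also have "\<dots> = 0"
      by (rule sum_scalar_prod_centered[OF I s d])
    finally have 1: "(\<Sum>i\<in>I. (s i - ?\<mu>) \<bullet> d) = 0" .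
    have "(\<Sum>i\<in>I. \<Sum>l<m. (col A l \<bullet> (s i - ?\<mu>)) * (col A l \<bullet> d) / (col A l \<bullet> col A l))
        = (\<Sum>l<m. (\<Sum>i\<in>I. col A l \<bullet> (s i - ?\<mu>)) * (col A l \<bullet> d) / (col A l \<bullet> col A l))"
      by (subst sum.swap) (simp add: sum_distrib_right sum_divide_distrib)
    also have "\<dots> = 0"
    proof -
      have "(\<Sum>i\<in>I. col A l \<bullet> (s i - ?\<mu>)) = 0" for l
        using A by (intro sum_scalar_prod_centered[OF I s]) auto
      then show ?thesis by simp
    qed
    finally show ?thesis
      using 1 A by (simp add: defect_def sum_subtractf)
  qed
  have "(\<Sum>i\<in>I. defect A (s i - b) (s i - b))
      = (\<Sum>i\<in>I. defect A (s i - ?\<mu>) (s i - ?\<mu>) + 2 * defect A (s i - ?\<mu>) d + defect A d d)"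
  proof (intro sum.cong refl)
    fix i assume i: "i \<in> I"
    show "defect A (s i - b) (s i - b)
        = defect A (s i - ?\<mu>) (s i - ?\<mu>) + 2 * defect A (s i - ?\<mu>) d + defect A d d"
      unfolding shift[OF i] using s[OF i] d by (intro defect_add_square[OF A]) auto
  qed
  also have "\<dots> = (\<Sum>i\<in>I. defect A (s i - ?\<mu>) (s i - ?\<mu>)) + real (card I) * defect A d d"
    using cross by (simp add: sum.distrib sum_distrib_left[symmetric])
  finally show ?thesis
    using defect_nonneg[OF A diag d] by simp
qed

section \<open>Optimality of the fitting step\<close>

lemma finite_cluster [simp]: "finite (cluster M J j)"
  by (simp add: cluster_def)

text \<open>The basis is exchanged first, with the offset at the mean, since \<open>B\<close> comes
  from the rows centred there; then the offset is moved with \<open>A\<close> kept.\<close>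

lemma fit_cluster_optimal:
  assumes s: "\<And>i. i \<in> {1..M} \<Longrightarrow> s i \<in> carrier_vec n"
    and \<phi>: "cluster M J j \<noteq> {} \<Longrightarrow> \<phi> j = mean_vec n s (cluster M J j)"
    and basis: "svd_basis m (centered_mat n M s J \<phi> j) B"
    and A: "A \<in> carrier_mat n m" and diag: "diagonal_mat (transpose_mat A * A)"
    and b: "b \<in> carrier_vec n"
  shows "(\<Sum>i\<in>cluster M J j. residual (s i) B (\<phi> j)) \<le> (\<Sum>i\<in>cluster M J j. residual (s i) A b)"
\<comment> \<open>The offset of an empty cluster is not a mean, but then both sums are
  empty.\<close>
proof (cases "cluster M J j = {}")
  case False
  define I where "I = cluster M J j"
  have I: "finite I" "I \<noteq> {}" and sI: "\<And>i. i \<in> I \<Longrightarrow> s i \<in> carrier_vec n"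
    using False s by (auto simp: I_def cluster_def)
  have \<phi>: "\<phi> j = mean_vec n s I" using \<phi>[OF False] by (simp add: I_def)
  then have \<phi>_carrier: "\<phi> j \<in> carrier_vec n" by simp
  define S where "S = centered_mat n M s J \<phi> j"
  define xs where "xs = sorted_list_of_set I"
  define N where "N = length xs"
  have set_xs: "set xs = I" and "distinct xs"
    using I by (auto simp: xs_def)
  \<comment> \<open>Row \<open>k\<close> of the centred matrix belongs to sample
    \<open>xs ! k\<close>, so sums over rows become sums over the cluster.\<close>
  then have bij: "bij_betw ((!) xs) {..<N} I"
    unfolding N_def by (intro bij_betw_nth) auto
  have S_eq: "S = mat_of_rows n (map (\<lambda>i. s i - \<phi> j) xs)"
    by (simp add: S_def centered_mat_def xs_def I_def)
  have S: "S \<in> carrier_mat N n"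
    unfolding S_eq N_def by (intro carrier_matI) simp_all
  have row: "row S k = s (xs ! k) - \<phi> j" if "k < N" for k
  proof -
    have "xs ! k \<in> I" using that set_xs by (auto simp: N_def)
    then show ?thesis
      unfolding S_eq using that sI \<phi>_carrier by (subst mat_of_rows_row) (auto simp: N_def)
  qed
  have sum_rows: "(\<Sum>k<N. defect C (row S k) (row S k)) = (\<Sum>i\<in>I. defect C (s i - \<phi> j) (s i - \<phi> j))" for C
    by (subst sum.reindex_bij_betw[OF bij, symmetric]) (simp add: row)
  have B: "B \<in> carrier_mat n m" and B_diag: "diagonal_mat (transpose_mat B * B)"
    using basis S unfolding svd_basis_def S_def[symmetric] by (auto simp: diagonal_mat_one)
  have "(\<Sum>i\<in>I. residual (s i) B (\<phi> j)) = (\<Sum>i\<in>I. defect B (s i - \<phi> j) (s i - \<phi> j))"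
    using residual_eq_defect[OF B B_diag] sI \<phi>_carrier by simp
  also have "\<dots> \<le> (\<Sum>i\<in>I. defect A (s i - \<phi> j) (s i - \<phi> j))"
    using svd_basis_min_sum_defect[OF S _ A diag] basis unfolding S_def[symmetric] sum_rows by simp
  also have "\<dots> \<le> (\<Sum>i\<in>I. defect A (s i - b) (s i - b))"
    unfolding \<phi> by (rule mean_min_sum_defect[OF I sI A diag b])
  also have "\<dots> = (\<Sum>i\<in>I. residual (s i) A b)"
    using residual_eq_defect[OF A diag] sI b by simp
  finally show ?thesis by (simp add: I_def)
qed simp

text \<open>For fixed labels the problem splits into independent problems, one per cluster.\<close>

lemma objective_cluster_sum:
  assumes "J \<in> label_vectors M K"
  shows "objective M s J \<Phi> \<phi> = (\<Sum>j = 1..K. \<Sum>i\<in>cluster M J j. residual (s i) (\<Phi> j) (\<phi> j))"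
proof -
  have "J ` {1..M} \<subseteq> {1..K}"
    using assms by (auto simp: label_vectors_def)
  then have "objective M s J \<Phi> \<phi>
      = (\<Sum>j = 1..K. \<Sum>i\<in>{i \<in> {1..M}. J i = j}. residual (s i) (\<Phi> (J i)) (\<phi> (J i)))"
    unfolding objective_def by (intro sum.group[symmetric]) auto
  also have "\<dots> = (\<Sum>j = 1..K. \<Sum>i\<in>cluster M J j. residual (s i) (\<Phi> j) (\<phi> j))"
    by (intro sum.cong) (auto simp: cluster_def)
  finally show ?thesis .
qed

text \<open>The competing offsets need not be means of the current clusters; this allows comparison
  with bases and offsets fitted to other labels.\<close>

lemma fit_step_optimal:
  assumes s: "\<And>i. i \<in> {1..M} \<Longrightarrow> s i \<in> carrier_vec n"
    and J: "J \<in> label_vectors M K" and fit: "fit_step n m M K s J \<Phi> \<phi>"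
    and \<Phi>': "\<And>j. j \<in> {1..K} \<Longrightarrow> \<Phi>' j \<in> carrier_mat n m \<and> diagonal_mat (transpose_mat (\<Phi>' j) * \<Phi>' j)"
    and \<phi>': "\<And>j. j \<in> {1..K} \<Longrightarrow> \<phi>' j \<in> carrier_vec n"
  shows "objective M s J \<Phi> \<phi> \<le> objective M s J \<Phi>' \<phi>'"
  unfolding objective_cluster_sum[OF J]
proof (rule sum_mono)
  fix j assume j: "j \<in> {1..K}"
  show "(\<Sum>i\<in>cluster M J j. residual (s i) (\<Phi> j) (\<phi> j))
      \<le> (\<Sum>i\<in>cluster M J j. residual (s i) (\<Phi>' j) (\<phi>' j))"
    using fit j \<Phi>'[OF j] \<phi>'[OF j] s
    by (intro fit_cluster_optimal[where n = n and m = m])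
       (auto simp: fit_step_def offsets_are_means_def)
qed

lemma fit_step_basis:
  assumes "fit_step n m M K s J \<Phi> \<phi>" "j \<in> {1..K}"
  shows "\<Phi> j \<in> carrier_mat n m" "diagonal_mat (transpose_mat (\<Phi> j) * \<Phi> j)" "\<phi> j \<in> carrier_vec n"
  using assms
  by (auto simp: fit_step_def offsets_are_means_def svd_basis_def centered_mat_def diagonal_mat_one)

lemma fit_step_feasible:
  assumes "fit_step n m M K s J \<Phi> \<phi>" "J \<in> label_vectors M K"
  shows "feasible n m M K s J \<Phi> \<phi>"
  using assms fit_step_basis[OF assms(1)] by (auto simp: feasible_def fit_step_def)

lemma fit_step_local_minimum:
  assumes "\<And>i. i \<in> {1..M} \<Longrightarrow> s i \<in> carrier_vec n"
    and "J \<in> label_vectors M K" "fit_step n m M K s J \<Phi> \<phi>"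
  shows "local_minimum n m M K s J \<Phi> \<phi>"
  unfolding local_minimum_def
\<comment> \<open>The radius 1 is arbitrary: for fixed labels the fit beats all feasible
  competitors, near or far.\<close>
proof (intro conjI exI[of _ 1] allI impI)
  show "feasible n m M K s J \<Phi> \<phi>"
    using fit_step_feasible assms by blast
  fix J' \<Phi>' \<phi>'
  assume "feasible n m M K s J' \<Phi>' \<phi>' \<and> J' = J \<and>
    (\<forall>j\<in>{1..K}. \<forall>a<n. \<bar>\<phi>' j $ a - \<phi> j $ a\<bar> < 1 \<and>
      (\<forall>b<m. \<bar>\<Phi>' j $$ (a, b) - \<Phi> j $$ (a, b)\<bar> < 1))"
  then have feas: "feasible n m M K s J \<Phi>' \<phi>'" and [simp]: "J' = J" by auto
  have "objective M s J \<Phi> \<phi> \<le> objective M s J \<Phi>' \<phi>'"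
    by (rule fit_step_optimal[OF assms]) (use feas in \<open>auto simp: feasible_def offsets_are_means_def\<close>)
  then show "objective M s J \<Phi> \<phi> \<le> objective M s J' \<Phi>' \<phi>'" by simp
qed simp

section \<open>Reassignment of labels\<close>

lemma best_label_le:
  assumes "best_label K \<Phi> \<phi> x j" "k \<in> {1..K}"
  shows "residual x (\<Phi> j) (\<phi> j) \<le> residual x (\<Phi> k) (\<phi> k)"
  using assms unfolding best_label_def is_arg_min_def by (meson not_le)

lemma assign_step_le:
  assumes "assign_step M K s \<Phi> \<phi> J J'" "J'' \<in> label_vectors M K" "i \<in> {1..M}"
  shows "residual (s i) (\<Phi> (J' i)) (\<phi> (J' i)) \<le> residual (s i) (\<Phi> (J'' i)) (\<phi> (J'' i))"
  using assms by (intro best_label_le[of K]) (auto simp: assign_step_def label_vectors_def)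

text \<open>With bases and offsets fixed, each summand depends on one label only, so the objective
  is minimised sample by sample.\<close>

lemma assign_step_optimal:
  assumes "assign_step M K s \<Phi> \<phi> J J'" "J'' \<in> label_vectors M K"
  shows "objective M s J' \<Phi> \<phi> \<le> objective M s J'' \<Phi> \<phi>"
  unfolding objective_def using assms by (intro sum_mono assign_step_le)

text \<open>If the reassignment does not improve the objective, every present label is already a
  minimiser, so the tie-breaking rule applies to all samples.\<close>

lemma assign_step_tie:
  assumes step: "assign_step M K s \<Phi> \<phi> J J'" and J: "J \<in> label_vectors M K"
    and eq: "objective M s J' \<Phi> \<phi> = objective M s J \<Phi> \<phi>" and i: "i \<in> {1..M}"
  shows "J' i \<le> J i"
proof -
  have "residual (s i) (\<Phi> (J' i)) (\<phi> (J' i)) = residual (s i) (\<Phi> (J i)) (\<phi> (J i))"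
    using sum_mono_inv[OF eq[unfolded objective_def] assign_step_le[OF step J] i] by simp
  moreover have "J i \<in> {1..K}" using J i by (auto simp: label_vectors_def)
  moreover have "best_label K \<Phi> \<phi> (s i) (J' i)" using step i by (auto simp: assign_step_def)
  ultimately have "best_label K \<Phi> \<phi> (s i) (J i)"
    by (simp add: best_label_def is_arg_min_def)
  then show ?thesis using step i by (simp add: assign_step_def)
qed

section \<open>Stabilisation of the labels\<close>

lemma decseq_finite_range_eventually_const:
  fixes F :: "nat \<Rightarrow> 'a::linorder"
  assumes "decseq F" "finite (range F)"
  obtains N where "\<And>t. t \<ge> N \<Longrightarrow> F t = F N"
proof -
  have "Min (range F) \<in> range F" using assms(2) by (intro Min_in) auto
  then obtain N where N: "F N = Min (range F)" by auto
  have "F t = F N" if "t \<ge> N" for t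
    using decseqD[OF assms(1) that] N assms(2) by (simp add: order_antisym)
  then show ?thesis using that by blast
qed

lemma ksvd_run_labels:
  assumes "ksvd_run n m M K s I\<^sub>0 J \<Phi> \<phi>"
  shows "J t \<in> label_vectors M K"
  using assms by (cases t) (auto simp: ksvd_run_def assign_step_def)

lemma ksvd_run_finite:
  assumes s: "\<And>i. i \<in> {1..M} \<Longrightarrow> s i \<in> carrier_vec n"
    and run: "ksvd_run n m M K s I\<^sub>0 J \<Phi> \<phi>"
  shows "\<exists>N. \<forall>t\<ge>N. J t = J N"
proof -
  have fit: "fit_step n m M K s (J t) (\<Phi> t) (\<phi> t)"
    and step: "assign_step M K s (\<Phi> t) (\<phi> t) (J t) (J (Suc t))" for t
    using run by (auto simp: ksvd_run_def)
  note labels = ksvd_run_labels[OF run]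
  define F where "F t = objective M s (J t) (\<Phi> t) (\<phi> t)" for t
  \<comment> \<open>Used in two ways: with consecutive iterations it gives descent, and with two
    iterations that have equal labels it gives equal values.\<close>
  have refit: "F t \<le> objective M s (J t) (\<Phi> u) (\<phi> u)" for t u
    unfolding F_def using fit_step_basis[OF fit[of u]]
    by (intro fit_step_optimal[OF s labels fit]) auto
  have assign: "objective M s (J (Suc t)) (\<Phi> t) (\<phi> t) \<le> F t" for t
    unfolding F_def by (rule assign_step_optimal[OF step labels])
  have "decseq F"
    using refit[of "Suc _"] assign order_trans by (intro decseq_SucI) blast
  moreover have "finite (range F)"
  proof -
    \<comment> \<open>The two fits may use different decompositions, but each is optimal for the
      common labels.\<close>
    have same: "F t = F u" if "J t = J u" for t u
      using refit[of t u] refit[of u t] that by (simp add: F_def)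
    \<comment> \<open>Choosing one iteration per label vector makes \<open>F\<close> factor through
      the finite set of label vectors.\<close>
    have "F t = F (SOME u. J u = J t)" for t
      by (rule same, rule sym, rule someI[of "\<lambda>u. J u = J t"], rule refl)
    then have "range F \<subseteq> (\<lambda>L. F (SOME u. J u = L)) ` label_vectors M K"
      using labels by blast
    moreover have "finite (label_vectors M K)"
      unfolding label_vectors_def by (intro finite_PiE) auto
    ultimately show ?thesis by (meson finite_imageI finite_subset)
  qed
  ultimately obtain N where N: "\<And>t. t \<ge> N \<Longrightarrow> F t = F N"
    using decseq_finite_range_eventually_const by blast
  have label_le: "J (Suc t) i \<le> J t i" if "t \<ge> N" "i \<in> {1..M}" for t i
  proof (rule assign_step_tie[OF step labels _ that(2)])
    \<comment> \<open>The left side lies between \<open>F (Suc t)\<close> and \<open>F t\<close>,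
      which agree from \<open>N\<close> on.\<close>
    show "objective M s (J (Suc t)) (\<Phi> t) (\<phi> t) = objective M s (J t) (\<Phi> t) (\<phi> t)"
      using refit[of "Suc t" t] assign[of t] N[of t] N[of "Suc t"] that(1) by (simp add: F_def)
  qed
  \<comment> \<open>A second descent quantity, started at \<open>N\<close>, from where on no label
    increases.\<close>
  define G where "G t = (\<Sum>i = 1..M. J (N + t) i)" for t
  have "G (Suc t) \<le> G t" for t
    unfolding G_def add_Suc_right by (rule sum_mono, rule label_le) auto
  then have G: "decseq G" by (rule decseq_SucI)
  have "range G \<subseteq> {..G 0}"
    using decseqD[OF G, of 0] by auto
  then have "finite (range G)"
    by (rule finite_subset) simp
  with G obtain N' where N': "\<And>t. t \<ge> N' \<Longrightarrow> G t = G N'"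
    using decseq_finite_range_eventually_const by blast
  have stable: "J (Suc t) = J t" if t: "t \<ge> N + N'" for t
  proof (rule extensionalityI[of _ "{1..M}"])
    fix i assume i: "i \<in> {1..M}"
    have "G (Suc (t - N)) = G (t - N)"
      using N'[of "t - N"] N'[of "Suc (t - N)"] t by simp
    then have "(\<Sum>i = 1..M. J (Suc t) i) = (\<Sum>i = 1..M. J t i)"
      using t by (simp add: G_def)
    \<comment> \<open>Equal sums with termwise comparable summands force equality of every
      label.\<close>
    then show "J (Suc t) i = J t i"
      by (rule sum_mono_inv) (use label_le t i in auto)
  qed (use labels in \<open>auto simp: label_vectors_def PiE_def\<close>)
  have "J t = J (N + N')" if "t \<ge> N + N'" for t
    using that by (induction rule: dec_induct) (simp_all add: stable)
  then show ?thesis by blast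
qed

theorem mainTheorem1:
  fixes n m M K :: nat
    and s :: "nat \<Rightarrow> real vec"
    and I\<^sub>0 :: "nat \<Rightarrow> nat set"
    and J :: "nat \<Rightarrow> nat \<Rightarrow> nat"
    and \<Phi> :: "nat \<Rightarrow> nat \<Rightarrow> real mat"
    and \<phi> :: "nat \<Rightarrow> nat \<Rightarrow> real vec"
  assumes "M > n" and "n > m"
    and "\<And>i. i \<in> {1..M} \<Longrightarrow> s i \<in> carrier_vec n"
    and "(\<Union>j\<in>{1..K}. I\<^sub>0 j) = {1..M}"
    and "\<And>i j. i \<in> {1..K} \<Longrightarrow> j \<in> {1..K} \<Longrightarrow> i \<noteq> j \<Longrightarrow> I\<^sub>0 i \<inter> I\<^sub>0 j = {}"
    and "ksvd_run n m M K s I\<^sub>0 J \<Phi> \<phi>"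
  shows "(\<exists>N. \<forall>t\<ge>N. J t = J N) \<and>
    (\<forall>T. J (Suc T) = J T \<longrightarrow>
       local_minimum n m M K s (J T) (\<Phi> T) (\<phi> T) \<and>
       (\<forall>J'\<in>label_vectors M K. objective M s (J T) (\<Phi> T) (\<phi> T) \<le> objective M s J' (\<Phi> T) (\<phi> T)))"
proof (intro conjI allI impI)
  show "\<exists>N. \<forall>t\<ge>N. J t = J N"
    using ksvd_run_finite assms(3,6) by blast
next
  fix T assume stop: "J (Suc T) = J T"
  \<comment> \<open>When the loop stops, reassignment returns \<open>J T\<close> itself, so these
    labels are optimal for the bases and offsets fitted to them.\<close>
  have fit: "fit_step n m M K s (J T) (\<Phi> T) (\<phi> T)"
    and step: "assign_step M K s (\<Phi> T) (\<phi> T) (J T) (J T)"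
    using assms(6) stop by (auto simp: ksvd_run_def dest: spec[of _ T])
  show "local_minimum n m M K s (J T) (\<Phi> T) (\<phi> T)"
    by (rule fit_step_local_minimum[OF assms(3) ksvd_run_labels[OF assms(6)] fit])
  show "\<forall>J'\<in>label_vectors M K. objective M s (J T) (\<Phi> T) (\<phi> T) \<le> objective M s J' (\<Phi> T) (\<phi> T)"
    using assign_step_optimal[OF step] by blast
qed

end
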